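(* Let $c$ (with $X,Y$) satisfy the standing assumptions below, and suppose $c$ satisfies Loeper's condition. If there exist $r>0$ and $M\ge1$ such that $$F(v_t)-F(v_0)\le Mt\,(F(v_1)-F(v_0))_+\quad\text{for all }t\in[0,1]$$ holds for all $x_0,x_1\in X$ and all $v_0,v_1\in Y^*_{x_0}$ with $|v_1-v_0|\le r$, then $c$ is QQconv.
   Context: Standing assumptions: $X,Y\subset\mathbb{R}^n$ compact; $c:X\times Y\to\mathbb{R}$ measurable, differentiable, with mixed Hessians $D^2_{xy}c$, $D^2_{yx}c$ existing and $(D^2_{xy}c)^T=D^2_{yx}c$; $-D_xc(x,\cdot)$ injective on $Y$ for each $x$ and $-D_yc(\cdot,y)$ injective on $X$ for each $y$; $D^2_{xy}c(x,y)$ invertible everywhere; $D^2_{xy}c$ Lipschitz; $Y^*_x:=-D_xc(x,Y)$ convex for each $x\in X$ and $X^*_y:=-D_yc(X,y)$ convex for each $y\in Y$. The map $\exp^c_x:Y^*_x\to Y$ is the inverse of $-D_xc(x,\cdot)$. For $x_0,x_1\in X$, define $F:Y^*_{x_0}\to\mathbb{R}$ by $F(v)=-c(x_1,\exp^c_{x_0}(v))+c(x_0,\exp^c_{x_0}(v))$ (it depends on $x_0,x_1$), and $v_t=(1-t)v_0+tv_1$. Loeper's condition: $F(v_t)\le\max\{F(v_0),F(v_1)\}$ for all $x_0,x_1\in X$, $v_0,v_1\in Y^*_{x_0}$, $t\in[0,1]$. QQconv: there is $M'\ge1$ with $F(v_t)-F(v_0)\le M't\,(F(v_1)-F(v_0))_+$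 for all $x_0,x_1\in X$, $v_0,v_1\in Y^*_{x_0}$, $t\in[0,1]$; here $a_+=\max\{a,0\}$. *)

theory Defs
  imports "HOL-Analysis.Analysis"
begin

text \<open>Points of X, Y live in \<open>real^'n\<close>. The cost c is a total function
  on \<open>real^'n \<times> real^'n\<close>; only its behaviour at and near \<open>X \<times> Y\<close> matters.
  \<open>Dxc x y\<close> is the gradient of c in x, \<open>Dyc x y\<close> the gradient in y,
  \<open>Dxy x y\<close> is the mixed Hessian \<open>D^2_{xy} c\<close> (entry (i,j) = d/dy_j d/dx_i c),
  \<open>Dyx x y\<close> is \<open>D^2_{yx} c\<close>.\<close>

definition standing_assumptions ::
  "(real^'n::finite) set \<Rightarrow> (real^'n) set \<Rightarrow> (real^'n \<Rightarrow> real^'n \<Rightarrow> real)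
   \<Rightarrow> (real^'n \<Rightarrow> real^'n \<Rightarrow> real^'n) \<Rightarrow> (real^'n \<Rightarrow> real^'n \<Rightarrow> real^'n)
   \<Rightarrow> (real^'n \<Rightarrow> real^'n \<Rightarrow> real^'n^'n) \<Rightarrow> (real^'n \<Rightarrow> real^'n \<Rightarrow> real^'n^'n) \<Rightarrow> bool"
where
  "standing_assumptions X Y c Dxc Dyc Dxy Dyx \<longleftrightarrow>
     compact X \<and> compact Y \<and>
     (\<lambda>p. c (fst p) (snd p)) \<in> borel_measurable (restrict_space borel (X \<times> Y)) \<and>
     \<comment> \<open>c differentiable at every point of X \<times> Y, with partial gradients Dxc, Dyc\<close>
     (\<forall>x\<in>X. \<forall>y\<in>Y. ((\<lambda>p. c (fst p) (snd p)) has_derivative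
          (\<lambda>p. Dxc x y \<bullet> fst p + Dyc x y \<bullet> snd p)) (at (x, y))) \<and>
     \<comment> \<open>mixed Hessians exist\<close>
     (\<forall>x\<in>X. \<forall>y\<in>Y. ((\<lambda>y'. Dxc x y') has_derivative (\<lambda>k. Dxy x y *v k)) (at y within Y)) \<and>
     (\<forall>x\<in>X. \<forall>y\<in>Y. ((\<lambda>x'. Dyc x' y) has_derivative (\<lambda>h. Dyx x y *v h)) (at x within X)) \<and>
     (\<forall>x\<in>X. \<forall>y\<in>Y. transpose (Dxy x y) = Dyx x y) \<and>
     \<comment> \<open>twist conditions\<close>
     (\<forall>x\<in>X. inj_on (\<lambda>y. - Dxc x y) Y) \<and>
     (\<forall>y\<in>Y. inj_on (\<lambda>x. - Dyc x y) X) \<and>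
     (\<forall>x\<in>X. \<forall>y\<in>Y. invertible (Dxy x y)) \<and>
     (\<exists>L. L-lipschitz_on (X \<times> Y) (\<lambda>p. Dxy (fst p) (snd p))) \<and>
     \<comment> \<open>convexity of the target sets\<close>
     (\<forall>x\<in>X. convex ((\<lambda>y. - Dxc x y) ` Y)) \<and>
     (\<forall>y\<in>Y. convex ((\<lambda>x. - Dyc x y) ` X))"

text \<open>\<open>Y*_x = -D_x c(x, Y)\<close>\<close>
definition Ystar :: "(real^'n::finite \<Rightarrow> real^'n \<Rightarrow> real^'n) \<Rightarrow> (real^'n) set \<Rightarrow> real^'n \<Rightarrow> (real^'n) set"
  where "Ystar Dxc Y x = (\<lambda>y. - Dxc x y) ` Y"

text \<open>\<open>exp^c_x\<close>: inverse of \<open>-D_x c(x,\<cdot>)\<close> on Y.\<close>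
definition cexp :: "(real^'n::finite \<Rightarrow> real^'n \<Rightarrow> real^'n) \<Rightarrow> (real^'n) set \<Rightarrow> real^'n \<Rightarrow> real^'n \<Rightarrow> real^'n"
  where "cexp Dxc Y x v = (THE y. y \<in> Y \<and> - Dxc x y = v)"

text \<open>\<open>F(v) = -c(x1, exp^c_{x0} v) + c(x0, exp^c_{x0} v)\<close>\<close>
definition Fc :: "(real^'n::finite \<Rightarrow> real^'n \<Rightarrow> real) \<Rightarrow> (real^'n \<Rightarrow> real^'n \<Rightarrow> real^'n) \<Rightarrow> (real^'n) set
     \<Rightarrow> real^'n \<Rightarrow> real^'n \<Rightarrow> real^'n \<Rightarrow> real"
  where "Fc c Dxc Y x0 x1 v = - c x1 (cexp Dxc Y x0 v) + c x0 (cexp Dxc Y x0 v)"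

definition loeper :: "(real^'n::finite) set \<Rightarrow> (real^'n) set \<Rightarrow> (real^'n \<Rightarrow> real^'n \<Rightarrow> real)
    \<Rightarrow> (real^'n \<Rightarrow> real^'n \<Rightarrow> real^'n) \<Rightarrow> bool" where
  "loeper X Y c Dxc \<longleftrightarrow>
     (\<forall>x0\<in>X. \<forall>x1\<in>X. \<forall>v0\<in>Ystar Dxc Y x0. \<forall>v1\<in>Ystar Dxc Y x0. \<forall>t\<in>{0..1::real}.
        Fc c Dxc Y x0 x1 ((1 - t) *\<^sub>R v0 + t *\<^sub>R v1)
          \<le> max (Fc c Dxc Y x0 x1 v0) (Fc c Dxc Y x0 x1 v1))"

definition QQconv :: "(real^'n::finite) set \<Rightarrow> (real^'n) set \<Rightarrow> (real^'n \<Rightarrow> real^'n \<Rightarrow> real)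
    \<Rightarrow> (real^'n \<Rightarrow> real^'n \<Rightarrow> real^'n) \<Rightarrow> bool" where
  "QQconv X Y c Dxc \<longleftrightarrow>
     (\<exists>M'\<ge>1. \<forall>x0\<in>X. \<forall>x1\<in>X. \<forall>v0\<in>Ystar Dxc Y x0. \<forall>v1\<in>Ystar Dxc Y x0. \<forall>t\<in>{0..1::real}.
        Fc c Dxc Y x0 x1 ((1 - t) *\<^sub>R v0 + t *\<^sub>R v1) - Fc c Dxc Y x0 x1 v0
          \<le> M' * t * max (Fc c Dxc Y x0 x1 v1 - Fc c Dxc Y x0 x1 v0) 0)"

end

theory Submission
  imports Defs
begin

(* Loeper's condition says that F is quasiconvex along segments, so F(v_t) - F(v_0) never
   exceeds F(v_1) - F(v_0).  On a segment longer than r, apply the local estimate to the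
   initial piece of length r and rescale it; beyond that piece quasiconvexity suffices.  Either
   way the constant grows only by the factor |v_1 - v_0| / r, which stays bounded because the
   sets Y*_x have uniformly bounded diameter.  That holds since, for a fixed x', every
   D_x c(x, .) is uniformly Lipschitz with respect to the chart -D_x c(x', .) of Y: the chart
   has convex image Y*_x', and the mixed Hessian is bounded on X x Y and uniformly invertible
   on {x'} x Y. *)

lemma linear_bounded_below_inverse:
  fixes f :: "'a::euclidean_space \<Rightarrow> 'a"
  assumes "linear f" and "\<delta> > 0" and below: "\<And>k. \<delta> * norm k \<le> norm (f k)"
  shows "\<exists>g. linear g \<and> (\<forall>k. g (f k) = k) \<and> (\<forall>k. norm (g k) \<le> norm k / \<delta>)"
proof -
  have "inj f"
    unfolding linear_inj_iff_eq_0[OF \<open>linear f\<close>]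
    using below \<open>\<delta> > 0\<close> by (metis mult_pos_pos norm_zero not_le zero_less_norm_iff)
  then obtain g where g: "linear g" "\<And>k. g (f k) = k" "\<And>k. f (g k) = k"
    using linear_injective_isomorphism[OF \<open>linear f\<close>] by blast
  have "norm (g k) \<le> norm k / \<delta>" for k
    using below[of "g k"] \<open>\<delta> > 0\<close> by (simp add: g(3) field_simps)
  with g show ?thesis by blast
qed

lemma norm_matrix_vector_mult_le:
  fixes A :: "real^'n^'m"
  shows "norm (A *v x) \<le> real CARD('m) * real CARD('n) * norm A * norm x"
proof -
  have "\<bar>A $ i $ j\<bar> \<le> norm A" for i j
  proof -
    have "\<bar>A $ i $ j\<bar> \<le> norm (A $ i)" by (rule component_le_norm_cart)
    also have "\<dots> \<le> norm A" by (rule Finite_Cartesian_Product.norm_nth_le)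
    finally show ?thesis .
  qed
  then have "onorm ((*v) A) \<le> real CARD('m) * real CARD('n) * norm A"
    by (rule onorm_le_matrix_component)
  have "norm (A *v x) \<le> onorm ((*v) A) * norm x"
    by (rule onorm[OF matrix_vector_mul_bounded_linear])
  also have "\<dots> \<le> real CARD('m) * real CARD('n) * norm A * norm x"
    by (rule mult_right_mono[OF \<open>onorm ((*v) A) \<le> _\<close> norm_ge_zero])
  finally show ?thesis .
qed

lemma continuous_on_matrix_vector_mult [continuous_intros]:
  fixes A :: "'a::topological_space \<Rightarrow> real^'n^'m"
  assumes "continuous_on S A" and "continuous_on S u"
  shows "continuous_on S (\<lambda>p. A p *v u p)"
  unfolding matrix_vector_mult_def
  by (intro continuous_intros continuous_on_component assms)

lemma compact_imp_matrix_vector_mult_bounded: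
  fixes A :: "'a::topological_space \<Rightarrow> real^'n^'m"
  assumes "compact S" and "continuous_on S A"
  obtains B where "B \<ge> 0" and "\<And>p k. p \<in> S \<Longrightarrow> norm (A p *v k) \<le> B * norm k"
proof -
  have "bounded (A ` S)"
    by (rule compact_imp_bounded[OF compact_continuous_image[OF assms(2,1)]])
  then obtain N where N: "\<forall>M \<in> A ` S. norm M \<le> N" unfolding bounded_iff ..
  have "0 \<le> real CARD('m) * real CARD('n) * max N 0" by simp
  moreover have "norm (A p *v k) \<le> real CARD('m) * real CARD('n) * max N 0 * norm k" if "p \<in> S" for p k
  proof -
    have "norm (A p *v k) \<le> real CARD('m) * real CARD('n) * norm (A p) * norm k"
      by (rule norm_matrix_vector_mult_le)
    also have "\<dots> \<le> real CARD('m) * real CARD('n) * max N 0 * norm k"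
      using N that by (intro mult_right_mono mult_left_mono) auto
    finally show ?thesis .
  qed
  ultimately show thesis by (rule that)
qed

lemma compact_invertible_imp_matrix_vector_mult_bounded_below:
  fixes A :: "'a::topological_space \<Rightarrow> real^'n^'n"
  assumes "compact S" and "continuous_on S A" and inv: "\<And>p. p \<in> S \<Longrightarrow> invertible (A p)"
  obtains \<delta> where "\<delta> > 0" and "\<And>p k. p \<in> S \<Longrightarrow> \<delta> * norm k \<le> norm (A p *v k)"
proof (cases "S = {}")
  case True
  then show thesis by (intro that[of 1]) auto
next
  case False
  define T where "T = S \<times> sphere (0::real^'n) 1"
  obtain u :: "real^'n" where "norm u = 1" using vector_choose_size[of 1] by auto
  with False have "T \<noteq> {}" unfolding T_def by auto
  have "compact T" unfolding T_def by (intro compact_Times \<open>compact S\<close> compact_sphere)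
  have "continuous_on T (\<lambda>q. A (fst q))"
    by (rule continuous_on_compose2[OF \<open>continuous_on S A\<close> continuous_on_fst]) (auto simp: T_def)
  then have "continuous_on T (\<lambda>q. norm (A (fst q) *v snd q))" by (intro continuous_intros)
  then obtain q0 where "q0 \<in> T" and min: "\<forall>q\<in>T. norm (A (fst q0) *v snd q0) \<le> norm (A (fst q) *v snd q)"
    using continuous_attains_inf[OF \<open>compact T\<close> \<open>T \<noteq> {}\<close>] by blast
  define \<delta> where "\<delta> = norm (A (fst q0) *v snd q0)"
  have "fst q0 \<in> S" and "snd q0 \<noteq> 0" using \<open>q0 \<in> T\<close> by (auto simp: T_def)
  then have "A (fst q0) *v snd q0 \<noteq> A (fst q0) *v 0"
    using injD[OF inj_matrix_vector_mult[OF inv]] by blast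
  then have "\<delta> > 0" unfolding \<delta>_def by simp
  moreover have "\<delta> * norm k \<le> norm (A p *v k)" if "p \<in> S" for p k
  proof (cases "k = 0")
    case False
    have "(p, k /\<^sub>R norm k) \<in> T" using that False by (simp add: T_def)
    with min have "\<delta> \<le> norm (A p *v (k /\<^sub>R norm k))"
      unfolding \<delta>_def by fastforce
    also have "\<dots> = norm (A p *v k) / norm k" by (simp add: matrix_vector_mult_scaleR divide_inverse_commute)
    finally show ?thesis using False by (simp add: field_simps)
  qed simp
  ultimately show thesis by (rule that)
qed

lemma has_derivative_the_inv_into_bounded:
  fixes h :: "'a::euclidean_space \<Rightarrow> 'a"
  assumes "compact Y" and "inj_on h Y" and "\<delta> > 0"
    and dh: "\<And>y. y \<in> Y \<Longrightarrow> (h has_derivative h' y) (at y within Y)"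
    and h'_below: "\<And>y k. y \<in> Y \<Longrightarrow> \<delta> * norm k \<le> norm (h' y k)"
  obtains G where "\<And>y. y \<in> Y \<Longrightarrow> (the_inv_into Y h has_derivative G y) (at (h y) within h ` Y)"
    and "\<And>y k. y \<in> Y \<Longrightarrow> norm (G y k) \<le> norm k / \<delta>"
proof -
  have "\<forall>y\<in>Y. \<exists>G. linear G \<and> (\<forall>k. G (h' y k) = k) \<and> (\<forall>k. norm (G k) \<le> norm k / \<delta>)"
    using linear_bounded_below_inverse[OF has_derivative_linear[OF dh] \<open>\<delta> > 0\<close> h'_below] by blast
  from bchoice[OF this] obtain G
    where G: "\<forall>y\<in>Y. linear (G y) \<and> (\<forall>k. G y (h' y k) = k) \<and> (\<forall>k. norm (G y k) \<le> norm k / \<delta>)" ..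
  have cont: "continuous_on (h ` Y) (the_inv_into Y h)"
    using continuous_on_inv_into[OF has_derivative_continuous_on[OF dh] \<open>compact Y\<close> \<open>inj_on h Y\<close>] .
  have "(the_inv_into Y h has_derivative G y) (at (h y) within h ` Y)" if "y \<in> Y" for y
  proof (rule has_derivative_inverse_within[OF dh[OF that] _ that])
    show "continuous (at (h y) within h ` Y) (the_inv_into Y h)"
      using cont that by (simp add: continuous_on_eq_continuous_within)
    show "linear (G y)" using G that by blast
    show "G y \<circ> h' y = id" using G that by (simp add: fun_eq_iff)
    show "the_inv_into Y h (h z) = z" if "z \<in> Y" for z
      using \<open>inj_on h Y\<close> that by (rule the_inv_into_f_f)
  qed
  with G show thesis using that by blast
qed

lemma norm_diff_le_via_convex_chart:
  fixes h :: "'a::euclidean_space \<Rightarrow> 'a" and \<phi> :: "'a \<Rightarrow> 'b::real_normed_vector"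
  assumes "compact Y" and "inj_on h Y" and "convex (h ` Y)" and "\<delta> > 0"
    and dh: "\<And>y. y \<in> Y \<Longrightarrow> (h has_derivative h' y) (at y within Y)"
    and h'_below: "\<And>y k. y \<in> Y \<Longrightarrow> \<delta> * norm k \<le> norm (h' y k)"
    and d\<phi>: "\<And>y. y \<in> Y \<Longrightarrow> (\<phi> has_derivative \<phi>' y) (at y within Y)"
    and \<phi>'_above: "\<And>y k. y \<in> Y \<Longrightarrow> norm (\<phi>' y k) \<le> B * norm k"
    and "y0 \<in> Y" and "y1 \<in> Y"
  shows "norm (\<phi> y1 - \<phi> y0) \<le> B / \<delta> * norm (h y1 - h y0)"
proof -
  define g where "g = the_inv_into Y h"
  have gh: "\<And>y. y \<in> Y \<Longrightarrow> g (h y) = y"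
    unfolding g_def using \<open>inj_on h Y\<close> by (simp add: the_inv_into_f_f)
  obtain G where dg: "\<And>y. y \<in> Y \<Longrightarrow> (g has_derivative G y) (at (h y) within h ` Y)"
    and G: "\<And>y k. y \<in> Y \<Longrightarrow> norm (G y k) \<le> norm k / \<delta>"
    using has_derivative_the_inv_into_bounded[OF assms(1,2,4) dh h'_below] unfolding g_def by blast
  obtain b :: 'a where "b \<in> Basis" using nonempty_Basis by blast
  then have "norm (\<phi>' y0 b) \<le> B" using \<phi>'_above[OF \<open>y0 \<in> Y\<close>, of b] by simp
  then have "B \<ge> 0" by (rule order_trans[OF norm_ge_zero])
  have d\<phi>g: "(\<phi> \<circ> g has_derivative \<phi>' (g v) \<circ> G (g v)) (at v within h ` Y)" if "v \<in> h ` Y" for v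
  proof -
    obtain y where y: "y \<in> Y" "v = h y" using \<open>v \<in> h ` Y\<close> by auto
    have "g ` h ` Y = Y" using gh by force
    then have "(\<phi> has_derivative \<phi>' y) (at (g (h y)) within g ` h ` Y)"
      using d\<phi>[OF y(1)] gh[OF y(1)] by simp
    with dg[OF y(1)] have "(\<phi> \<circ> g has_derivative \<phi>' y \<circ> G y) (at (h y) within h ` Y)"
      by (rule diff_chain_within)
    then show ?thesis using gh[OF y(1)] y(2) by simp
  qed
  have onorm_bound: "onorm (\<phi>' (g v) \<circ> G (g v)) \<le> B / \<delta>" if "v \<in> h ` Y" for v
  proof (rule onorm_le)
    fix k
    have "g v \<in> Y" using that gh by auto
    have "norm (\<phi>' (g v) (G (g v) k)) \<le> B * norm (G (g v) k)" by (rule \<phi>'_above[OF \<open>g v \<in> Y\<close>])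
    also have "\<dots> \<le> B * (norm k / \<delta>)" by (rule mult_left_mono[OF G[OF \<open>g v \<in> Y\<close>] \<open>B \<ge> 0\<close>])
    finally show "norm ((\<phi>' (g v) \<circ> G (g v)) k) \<le> B / \<delta> * norm k" by simp
  qed
  have "norm ((\<phi> \<circ> g) (h y1) - (\<phi> \<circ> g) (h y0)) \<le> B / \<delta> * norm (h y1 - h y0)"
    using \<open>y0 \<in> Y\<close> \<open>y1 \<in> Y\<close>
    by (intro differentiable_bound[OF \<open>convex (h ` Y)\<close> d\<phi>g onorm_bound] imageI)
  then show ?thesis using gh \<open>y0 \<in> Y\<close> \<open>y1 \<in> Y\<close> by simp
qed

lemma Dxc_diff_le_reference_diff:
  assumes SA: "standing_assumptions X Y c Dxc Dyc Dxy Dyx" and "xs \<in> X"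
  obtains K where "K \<ge> 0" and "\<And>x y0 y1. x \<in> X \<Longrightarrow> y0 \<in> Y \<Longrightarrow> y1 \<in> Y \<Longrightarrow>
                    norm (Dxc x y1 - Dxc x y0) \<le> K * norm (Dxc xs y1 - Dxc xs y0)"
proof -
  have "compact X" "compact Y" and
    dDxc: "\<And>x y. x \<in> X \<Longrightarrow> y \<in> Y \<Longrightarrow> (Dxc x has_derivative (*v) (Dxy x y)) (at y within Y)"
    using SA by (auto simp: standing_assumptions_def)
  obtain L where "L-lipschitz_on (X \<times> Y) (\<lambda>p. Dxy (fst p) (snd p))"
    using SA by (auto simp: standing_assumptions_def)
  then have cont: "continuous_on (X \<times> Y) (\<lambda>p. Dxy (fst p) (snd p))"
    by (rule lipschitz_on_continuous_on)
  obtain B where "B \<ge> 0" and B: "\<And>p k. p \<in> X \<times> Y \<Longrightarrow> norm (Dxy (fst p) (snd p) *v k) \<le> B * norm k"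
    using compact_imp_matrix_vector_mult_bounded[OF compact_Times[OF \<open>compact X\<close> \<open>compact Y\<close>] cont] by blast
  have "continuous_on Y (\<lambda>y. (xs, y))" by (intro continuous_intros)
  from continuous_on_compose2[OF cont this] have "continuous_on Y (Dxy xs)"
    using \<open>xs \<in> X\<close> by auto
  moreover have "\<And>y. y \<in> Y \<Longrightarrow> invertible (Dxy xs y)"
    using SA \<open>xs \<in> X\<close> by (auto simp: standing_assumptions_def)
  ultimately obtain \<delta> where "\<delta> > 0" and below: "\<And>y k. y \<in> Y \<Longrightarrow> \<delta> * norm k \<le> norm (Dxy xs y *v k)"
    using compact_invertible_imp_matrix_vector_mult_bounded_below[OF \<open>compact Y\<close>] by blast
  have "norm (Dxc x y1 - Dxc x y0) \<le> B / \<delta> * norm (Dxc xs y1 - Dxc xs y0)"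
    if "x \<in> X" "y0 \<in> Y" "y1 \<in> Y" for x y0 y1
  proof -
    have "norm (Dxc x y1 - Dxc x y0) \<le> B / \<delta> * norm (- Dxc xs y1 - - Dxc xs y0)"
    proof (rule norm_diff_le_via_convex_chart[OF \<open>compact Y\<close> _ _ \<open>\<delta> > 0\<close> _ _ dDxc[OF \<open>x \<in> X\<close>]])
      show "inj_on (\<lambda>y. - Dxc xs y) Y" "convex ((\<lambda>y. - Dxc xs y) ` Y)"
        using SA \<open>xs \<in> X\<close> unfolding standing_assumptions_def by auto
      show "((\<lambda>y. - Dxc xs y) has_derivative (\<lambda>k. - (Dxy xs y *v k))) (at y within Y)" if "y \<in> Y" for y
        by (intro has_derivative_minus dDxc[OF \<open>xs \<in> X\<close> that])
      show "\<delta> * norm k \<le> norm (- (Dxy xs y *v k))" if "y \<in> Y" for y k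
        using below[OF that] by simp
      show "norm (Dxy x y *v k) \<le> B * norm k" if "y \<in> Y" for y k
        using B[of "(x, y)"] \<open>x \<in> X\<close> that by simp
    qed (use that in simp_all)
    then show ?thesis by (simp add: norm_minus_commute)
  qed
  moreover have "B / \<delta> \<ge> 0" using \<open>B \<ge> 0\<close> \<open>\<delta> > 0\<close> by simp
  ultimately show thesis using that by blast
qed

lemma Ystar_diameter_bounded:
  assumes SA: "standing_assumptions X Y c Dxc Dyc Dxy Dyx"
  obtains D where "\<And>x v w. x \<in> X \<Longrightarrow> v \<in> Ystar Dxc Y x \<Longrightarrow> w \<in> Ystar Dxc Y x \<Longrightarrow> norm (v - w) \<le> D"
proof (cases "X = {}")
  case True
  then show thesis by (intro that) auto
next
  case False
  then obtain xs where "xs \<in> X" by blast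
  obtain K where "K \<ge> 0" and K: "\<And>x y0 y1. x \<in> X \<Longrightarrow> y0 \<in> Y \<Longrightarrow> y1 \<in> Y \<Longrightarrow>
                    norm (Dxc x y1 - Dxc x y0) \<le> K * norm (Dxc xs y1 - Dxc xs y0)"
    using Dxc_diff_le_reference_diff[OF SA \<open>xs \<in> X\<close>] by blast
  have "compact Y" and "\<And>y. y \<in> Y \<Longrightarrow> (Dxc xs has_derivative (*v) (Dxy xs y)) (at y within Y)"
    using SA \<open>xs \<in> X\<close> by (auto simp: standing_assumptions_def)
  then have "continuous_on Y (\<lambda>y. - Dxc xs y)"
    by (intro continuous_intros has_derivative_continuous_on)
  then have "bounded (Ystar Dxc Y xs)"
    unfolding Ystar_def by (intro compact_imp_bounded compact_continuous_image \<open>compact Y\<close>)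
  have "norm (v - w) \<le> K * diameter (Ystar Dxc Y xs)"
    if "x \<in> X" and vw_in: "v \<in> Ystar Dxc Y x" "w \<in> Ystar Dxc Y x" for x v w
  proof -
    obtain y0 y1 where "y0 \<in> Y" "y1 \<in> Y" and vw: "v = - Dxc x y0" "w = - Dxc x y1"
      using vw_in unfolding Ystar_def by blast
    have "norm (v - w) \<le> K * norm (Dxc xs y1 - Dxc xs y0)"
      using K[OF \<open>x \<in> X\<close> \<open>y0 \<in> Y\<close> \<open>y1 \<in> Y\<close>] vw by (simp add: norm_minus_commute)
    also have "\<dots> \<le> K * diameter (Ystar Dxc Y xs)"
    proof (rule mult_left_mono[OF _ \<open>K \<ge> 0\<close>])
      have "- Dxc xs y0 \<in> Ystar Dxc Y xs" "- Dxc xs y1 \<in> Ystar Dxc Y xs"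
        using \<open>y0 \<in> Y\<close> \<open>y1 \<in> Y\<close> unfolding Ystar_def by auto
      from diameter_bounded_bound[OF \<open>bounded (Ystar Dxc Y xs)\<close> this]
      show "norm (Dxc xs y1 - Dxc xs y0) \<le> diameter (Ystar Dxc Y xs)"
        by (simp add: dist_norm)
    qed
    finally show ?thesis .
  qed
  then show thesis by (rule that)
qed

lemma linear_growth_from_local_on_interval:
  fixes f :: "real \<Rightarrow> real"
  assumes quasiconvex: "\<And>t. t \<in> {0..1} \<Longrightarrow> f t \<le> max (f 0) (f 1)"
    and local: "\<And>s t. s \<in> {0..1} \<Longrightarrow> s * L \<le> r \<Longrightarrow> t \<in> {0..1} \<Longrightarrow>
                  f (t * s) - f 0 \<le> M * t * max (f s - f 0) 0"
    and "r > 0" and "M \<ge> 1" and "L \<le> D" and t: "t \<in> {0..1}"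
  shows "f t - f 0 \<le> M * max 1 (D / r) * t * max (f 1 - f 0) 0"
proof (cases "f 1 \<le> f 0")
  case True
  then show ?thesis using quasiconvex[OF t] by simp
next
  case False
  define \<Delta> where "\<Delta> = f 1 - f 0"
  have "\<Delta> > 0" using False unfolding \<Delta>_def by simp
  define s where "s = (if L \<le> r then 1 else r / L)"
  have "0 < s" "s \<le> 1" "s * L \<le> r" "1 / s \<le> max 1 (D / r)"
    using \<open>r > 0\<close> \<open>L \<le> D\<close> by (auto simp: s_def field_simps)
  have "f t - f 0 \<le> M * (t / s) * \<Delta>"
  proof (cases "t \<le> s")
    case True
    have "t / s \<in> {0..1}" using True t \<open>0 < s\<close> by auto
    have "f (t / s * s) - f 0 \<le> M * (t / s) * max (f s - f 0) 0"
      using local[OF _ \<open>s * L \<le> r\<close> \<open>t / s \<in> {0..1}\<close>] \<open>0 < s\<close> \<open>s \<le> 1\<close> by auto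
    also have "\<dots> \<le> M * (t / s) * \<Delta>"
      using quasiconvex[of s] \<open>0 < s\<close> \<open>s \<le> 1\<close> False \<open>M \<ge> 1\<close> t \<open>\<Delta> > 0\<close>
      by (intro mult_left_mono) (auto simp: \<Delta>_def)
    finally show ?thesis using \<open>0 < s\<close> by simp
  next
    case False
    have "f t - f 0 \<le> \<Delta>" using quasiconvex[OF t] \<open>\<Delta> > 0\<close> unfolding \<Delta>_def by auto
    also have "\<dots> \<le> M * (t / s) * \<Delta>"
      using False \<open>M \<ge> 1\<close> \<open>\<Delta> > 0\<close> \<open>0 < s\<close> mult_mono[OF \<open>M \<ge> 1\<close>, of 1 "t / s"]
      by (auto simp: field_simps)
    finally show ?thesis .
  qed
  also have "\<dots> \<le> M * max 1 (D / r) * t * \<Delta>"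
  proof -
    have ts: "t / s \<le> max 1 (D / r) * t"
      using mult_right_mono[OF \<open>1 / s \<le> max 1 (D / r)\<close>, of t] t by simp
    have "M * (t / s) \<le> M * max 1 (D / r) * t"
      using mult_left_mono[OF ts, of M] \<open>M \<ge> 1\<close> by (simp add: mult.assoc)
    then show ?thesis by (rule mult_right_mono) (use \<open>\<Delta> > 0\<close> in simp)
  qed
  finally show ?thesis using \<open>\<Delta> > 0\<close> unfolding \<Delta>_def by simp
qed

lemma linear_growth_from_local_on_convex:
  fixes F :: "'a::real_normed_vector \<Rightarrow> real"
  assumes "convex V"
    and quasiconvex: "\<And>v0 v1 t. v0 \<in> V \<Longrightarrow> v1 \<in> V \<Longrightarrow> t \<in> {0..1} \<Longrightarrow>
                        F ((1 - t) *\<^sub>R v0 + t *\<^sub>R v1) \<le> max (F v0) (F v1)"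
    and local: "\<And>v0 v1 t. v0 \<in> V \<Longrightarrow> v1 \<in> V \<Longrightarrow> norm (v1 - v0) \<le> r \<Longrightarrow> t \<in> {0..1} \<Longrightarrow>
                  F ((1 - t) *\<^sub>R v0 + t *\<^sub>R v1) - F v0 \<le> M * t * max (F v1 - F v0) 0"
    and diameter: "\<And>v w. v \<in> V \<Longrightarrow> w \<in> V \<Longrightarrow> norm (v - w) \<le> D"
    and "r > 0" and "M \<ge> 1" and "v0 \<in> V" and "v1 \<in> V" and "t \<in> {0..1}"
  shows "F ((1 - t) *\<^sub>R v0 + t *\<^sub>R v1) - F v0 \<le> M * max 1 (D / r) * t * max (F v1 - F v0) 0"
proof -
  define v where "v s = (1 - s) *\<^sub>R v0 + s *\<^sub>R v1" for s
  have v_in: "v s \<in> V" if "s \<in> {0..1}" for s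
    using convexD[OF \<open>convex V\<close> \<open>v0 \<in> V\<close> \<open>v1 \<in> V\<close>, of "1 - s" s] that by (simp add: v_def)
  have "F (v t) - F (v 0) \<le> M * max 1 (D / r) * t * max (F (v 1) - F (v 0)) 0"
  proof (rule linear_growth_from_local_on_interval[where L = "norm (v1 - v0)"])
    show "F (v s) \<le> max (F (v 0)) (F (v 1))" if "s \<in> {0..1}" for s
      using quasiconvex[OF \<open>v0 \<in> V\<close> \<open>v1 \<in> V\<close> that] by (simp add: v_def)
    show "F (v (\<tau> * s)) - F (v 0) \<le> M * \<tau> * max (F (v s) - F (v 0)) 0"
      if "s \<in> {0..1}" and "s * norm (v1 - v0) \<le> r" and "\<tau> \<in> {0..1}" for s \<tau>
    proof -
      have "v s - v0 = s *\<^sub>R (v1 - v0)" by (simp add: v_def algebra_simps)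
      then have "norm (v s - v0) \<le> r" using that(1,2) by simp
      moreover have "v (\<tau> * s) = (1 - \<tau>) *\<^sub>R v0 + \<tau> *\<^sub>R v s" by (simp add: v_def algebra_simps)
      ultimately show ?thesis
        using local[OF \<open>v0 \<in> V\<close> v_in[OF that(1)] _ that(3)] by (simp add: v_def)
    qed
  qed (use \<open>r > 0\<close> \<open>M \<ge> 1\<close> \<open>t \<in> {0..1}\<close> diameter[OF \<open>v1 \<in> V\<close> \<open>v0 \<in> V\<close>] in auto)
  then show ?thesis by (simp add: v_def)
qed

theorem lemma3p7:
  fixes X Y :: "(real^'n::finite) set"
    and c :: "real^'n \<Rightarrow> real^'n \<Rightarrow> real"
    and Dxc Dyc :: "real^'n \<Rightarrow> real^'n \<Rightarrow> real^'n"
    and Dxy Dyx :: "real^'n \<Rightarrow> real^'n \<Rightarrow> real^'n^'n"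
  assumes "standing_assumptions X Y c Dxc Dyc Dxy Dyx"
    and "loeper X Y c Dxc"
    and "\<exists>r>0. \<exists>M\<ge>1. \<forall>x0\<in>X. \<forall>x1\<in>X. \<forall>v0\<in>Ystar Dxc Y x0. \<forall>v1\<in>Ystar Dxc Y x0.
           norm (v1 - v0) \<le> r \<longrightarrow>
           (\<forall>t\<in>{0..1::real}.
              Fc c Dxc Y x0 x1 ((1 - t) *\<^sub>R v0 + t *\<^sub>R v1) - Fc c Dxc Y x0 x1 v0
                \<le> M * t * max (Fc c Dxc Y x0 x1 v1 - Fc c Dxc Y x0 x1 v0) 0)"
  shows "QQconv X Y c Dxc"
proof -
  obtain D where D: "\<And>x v w. x \<in> X \<Longrightarrow> v \<in> Ystar Dxc Y x \<Longrightarrow> w \<in> Ystar Dxc Y x \<Longrightarrow> norm (v - w) \<le> D"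
    using Ystar_diameter_bounded[OF assms(1)] by blast
  obtain r M where "r > 0" "M \<ge> 1" and local: "\<forall>x0\<in>X. \<forall>x1\<in>X. \<forall>v0\<in>Ystar Dxc Y x0. \<forall>v1\<in>Ystar Dxc Y x0.
           norm (v1 - v0) \<le> r \<longrightarrow> (\<forall>t\<in>{0..1::real}.
              Fc c Dxc Y x0 x1 ((1 - t) *\<^sub>R v0 + t *\<^sub>R v1) - Fc c Dxc Y x0 x1 v0
                \<le> M * t * max (Fc c Dxc Y x0 x1 v1 - Fc c Dxc Y x0 x1 v0) 0)"
    using assms(3) by blast
  have convex: "convex (Ystar Dxc Y x)" if "x \<in> X" for x
    using assms(1) that unfolding standing_assumptions_def Ystar_def by blast
  show ?thesis
    unfolding QQconv_def
  proof (intro exI[of _ "M * max 1 (D / r)"] conjI ballI)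
    show "1 \<le> M * max 1 (D / r)"
      using mult_mono[OF \<open>M \<ge> 1\<close> max.cobounded1[of 1 "D / r"]] \<open>M \<ge> 1\<close> by simp
    fix x0 x1 v0 v1 and t :: real
    assume x: "x0 \<in> X" "x1 \<in> X" and v: "v0 \<in> Ystar Dxc Y x0" "v1 \<in> Ystar Dxc Y x0" and "t \<in> {0..1}"
    show "Fc c Dxc Y x0 x1 ((1 - t) *\<^sub>R v0 + t *\<^sub>R v1) - Fc c Dxc Y x0 x1 v0
            \<le> M * max 1 (D / r) * t * max (Fc c Dxc Y x0 x1 v1 - Fc c Dxc Y x0 x1 v0) 0"
    proof (rule linear_growth_from_local_on_convex[OF convex[OF x(1)] _ _ _ \<open>r > 0\<close> \<open>M \<ge> 1\<close> v \<open>t \<in> {0..1}\<close>])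
      show "Fc c Dxc Y x0 x1 ((1 - s) *\<^sub>R w0 + s *\<^sub>R w1) \<le> max (Fc c Dxc Y x0 x1 w0) (Fc c Dxc Y x0 x1 w1)"
        if "w0 \<in> Ystar Dxc Y x0" "w1 \<in> Ystar Dxc Y x0" "s \<in> {0..1}" for w0 w1 s
        using assms(2) x that unfolding loeper_def by blast
    qed (use local x D in blast)+
  qed
qed

end
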